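(* If a group $G$ with finite presentation $\mathcal P$ satisfies an intrinsic [resp. extrinsic] tame filling inequality for a nondecreasing function $f:\mathbb N[\frac14]\to\mathbb N[\frac14]$, then the pair $(G,\mathcal P)$ also satisfies an intrinsic [resp. extrinsic] diameter inequality for the function $\hat f:\mathbb N\to\mathbb N$ defined by $\hat f(n)=\lceil f(n)\rceil$.
   Context: Conventions. $\mathbb N$ includes $0$, and $\mathbb N[\frac14]$ is the set of nonnegative integer multiples of $\frac14$. $A$ is a finite symmetric (inverse-closed) generating set of $G$, no element of which represents the identity $\epsilon$; $A^*$ is the set of words over $A$, $l(w)$ is word length; $=_G$ denotes equality in $G$. A presentation $\mathcal P=\langle A\mid R\rangle$ is symmetrized: $R$ is a set of nonempty words over $A$ closed under inversion and cyclic conjugation, and containing the freely reduced form of each of its elements unless that form is empty. $X$ is the Cayley 2-complex, with path metric $d_X$ on its 1-skeleton. A van Kampen diagram over $\mathcal P$ for $w\in A^*$ with $w=_G\epsilon$ is a finite, planar, contractible combinatorial 2-complex $\Delta$ with edges directed and labeled by $A$, whose boundary is an edge path labeled $w$ starting at a basepoint vertex $*$ and reading counterclockwise, every 2-cell having boundary labeled by an element of $R$ (not necessarily reduced). $d_\Delta$ is the path metric on $\Delta^1$. $\pi_\Delta:\Delta\to X$ is the canonical cellular map with $\pi_\Delta( * )=\epsilon$ preserving labels and directions. Diameter inequalities. $(G,\mathcal P)$ satisfies an intrinsic [resp. extrinsic] diameter inequality for a nondecreasing $h:\mathbb N\to\mathbb N$ if for all $w\in A^*$ with $w=_G\epsilon$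 there is a van Kampen diagram $\Delta$ for $w$ over $\mathcal P$ such that all vertices $v$ of $\Delta$ satisfy $d_\Delta( *,v)\le h(l(w))$ [resp. $d_X(\epsilon,\pi_\Delta(v))\le h(l(w))$]. Tame filling inequalities. Coarse distance: for a combinatorial 2-complex $Y$ with basepoint vertex $y$ and $p\in Y$: $\tilde d_Y(y,p)$ is the path metric distance in $Y^1$ if $p$ is a vertex; $\min\{\tilde d_Y(y,v)\mid v\in\partial e\}+\frac12$ if $p$ is in the interior of an edge $e$; and $\max\{\tilde d_Y(y,q)\mid q\in Int(e),\ e\text{ an edge of }\partial\sigma\}-\frac14$ if $p$ is in the interior of a 2-cell $\sigma$. A van Kampen homotopy of $\Delta$ is a continuous $\Psi:\partial\Delta\times[0,1]\to\Delta$ with $\Psi(p,0)=*$, $\Psi(p,1)=p$ for $p\in\partial\Delta$; $\Psi( *,t)=*$ for all $t$; and $\Psi(p,t)\in\Delta^1$ for all $t$ if $p$ is a vertex of $\partial\Delta$. $(G,\mathcal P)$ satisfies an intrinsic [resp. extrinsic] tame filling inequality for a nondecreasing $f:\mathbb N[\frac14]\to\mathbb N[\frac14]$ if every $w\in A^*$ with $w=_G\epsilon$ has a van Kampen diagram $\Delta$ and van Kampen homotopy $\Psi$ such that for all $p\in\partial\Delta$, $0\le s<t\le1$: $\tilde d_\Delta( *,\Psi(p,s))\le f(\tilde d_\Delta( *,\Psi(p,t)))$ [resp. $\tilde d_X(\epsilon,\pi_\Delta(\Psi(p,s)))\le f(\tilde d_X(\epsilon,\pi_\Delta(\Psi(p,t))))$].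 *)

theory Defs
  imports
    "HOL-Algebra.Generated_Groups"
    "HOL-Complex_Analysis.Winding_Numbers"
begin

section \<open>Words and presentations\<close>

text \<open>
  Letters are formal symbols: \<open>ainv\<close> is the formal inverse on the alphabet and \<open>val\<close> the group
  element a letter represents. The case of a symmetric subset of the group is
  \<open>ainv = (\<lambda>a. inv a)\<close>, \<open>val = id\<close>. Letters that are their own formal inverse, and distinct
  letters representing the same element, are both allowed.
\<close>

record ('a, 'g) pres =
  alph :: "'a set"
  ainv :: "'a \<Rightarrow> 'a"
  val :: "'a \<Rightarrow> 'g"
  rels :: "'a list set"

definition word_val :: "('g, 'm) monoid_scheme \<Rightarrow> ('a, 'g) pres \<Rightarrow> 'a list \<Rightarrow> 'g" where
  "word_val G P w = foldr (\<lambda>a x. val P a \<otimes>\<^bsub>G\<^esub> x) w \<one>\<^bsub>G\<^esub>"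

definition word_inv :: "('a, 'g) pres \<Rightarrow> 'a list \<Rightarrow> 'a list" where
  "word_inv P w = rev (map (ainv P) w)"

definition symmetric_generators :: "('g, 'm) monoid_scheme \<Rightarrow> ('a, 'g) pres \<Rightarrow> bool" where
  "symmetric_generators G P \<longleftrightarrow>
     finite (alph P) \<and>
     (\<forall>a\<in>alph P. ainv P a \<in> alph P \<and> ainv P (ainv P a) = a \<and>
        val P a \<in> carrier G \<and> val P (ainv P a) = inv\<^bsub>G\<^esub> (val P a) \<and> val P a \<noteq> \<one>\<^bsub>G\<^esub>) \<and>
     generate G (val P ` alph P) = carrier G"

inductive free_step :: "('a, 'g) pres \<Rightarrow> 'a list \<Rightarrow> 'a list \<Rightarrow> bool" for P where
  "a \<in> alph P \<Longrightarrow> free_step P (u @ [a, ainv P a] @ v) (u @ v)"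

definition freely_reduced_form :: "('a, 'g) pres \<Rightarrow> 'a list \<Rightarrow> 'a list \<Rightarrow> bool" where
  "freely_reduced_form P r u \<longleftrightarrow> (free_step P)\<^sup>*\<^sup>* r u \<and> (\<nexists>u'. free_step P u u')"

definition symmetrized :: "('a, 'g) pres \<Rightarrow> bool" where
  "symmetrized P \<longleftrightarrow>
     rels P \<subseteq> lists (alph P) \<and> [] \<notin> rels P \<and>
     (\<forall>r\<in>rels P. word_inv P r \<in> rels P \<and> (\<forall>n. rotate n r \<in> rels P) \<and>
        (\<forall>u. freely_reduced_form P r u \<longrightarrow> u \<noteq> [] \<longrightarrow> u \<in> rels P))"

inductive pres_step :: "('a, 'g) pres \<Rightarrow> 'a list \<Rightarrow> 'a list \<Rightarrow> bool" for P where
  free: "\<lbrakk>u \<in> lists (alph P); v \<in> lists (alph P); a \<in> alph P\<rbrakk>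
           \<Longrightarrow> pres_step P (u @ [a, ainv P a] @ v) (u @ v)"
| rel: "\<lbrakk>u \<in> lists (alph P); v \<in> lists (alph P); r \<in> rels P\<rbrakk>
           \<Longrightarrow> pres_step P (u @ r @ v) (u @ v)"

text \<open>\<open>P\<close> presents \<open>G\<close>: equality in \<open>G\<close> of words is the congruence generated by the relators
  together with free cancellation.\<close>

definition finite_presentation :: "('g, 'm) monoid_scheme \<Rightarrow> ('a, 'g) pres \<Rightarrow> bool" where
  "finite_presentation G P \<longleftrightarrow>
     group G \<and> symmetric_generators G P \<and> symmetrized P \<and> finite (rels P) \<and>
     (\<forall>u\<in>lists (alph P). \<forall>v\<in>lists (alph P).
        word_val G P u = word_val G P v \<longleftrightarrow> equivclp (pres_step P) u v)"

section \<open>Combinatorial 2-complexes\<close>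

text \<open>
  A complex is given by its vertices, its directed edges (each geometric edge occurs in two
  mutually inverse directions), its 2-cells, and characteristic maps from \<open>[0,1]\<close> and from the
  closed unit disc. The list \<open>fbdry f\<close> is the edge loop along which the boundary circle of the
  disc is attached.
\<close>

record ('p, 'e, 'f) complex2 =
  verts :: "'p set"
  edges :: "'e set"
  einv :: "'e \<Rightarrow> 'e"
  echar :: "'e \<Rightarrow> real \<Rightarrow> 'p"
  faces :: "'f set"
  fbdry :: "'f \<Rightarrow> 'e list"
  fchar :: "'f \<Rightarrow> complex \<Rightarrow> 'p"

definition open_edge :: "('p, 'e, 'f, 'm) complex2_scheme \<Rightarrow> 'e \<Rightarrow> 'p set" where
  "open_edge C e = echar C e ` {0<..<1}"

definition open_face :: "('p, 'e, 'f, 'm) complex2_scheme \<Rightarrow> 'f \<Rightarrow> 'p set" where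
  "open_face C f = fchar C f ` ball 0 1"

definition skeleton1 :: "('p, 'e, 'f, 'm) complex2_scheme \<Rightarrow> 'p set" where
  "skeleton1 C = verts C \<union> (\<Union>e\<in>edges C. open_edge C e)"

definition points :: "('p, 'e, 'f, 'm) complex2_scheme \<Rightarrow> 'p set" where
  "points C = skeleton1 C \<union> (\<Union>f\<in>faces C. open_face C f)"

fun edge_path :: "('p, 'e, 'f, 'm) complex2_scheme \<Rightarrow> 'p \<Rightarrow> 'e list \<Rightarrow> 'p \<Rightarrow> bool" where
  "edge_path C u [] v \<longleftrightarrow> u \<in> verts C \<and> u = v"
| "edge_path C u (e # es) v \<longleftrightarrow> e \<in> edges C \<and> echar C e 0 = u \<and> edge_path C (echar C e 1) es v"

text \<open>The map \<open>\<phi>\<close>, restricted to the unit circle, traverses the edge loop \<open>es\<close> at \<open>y\<close>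
  counterclockwise starting at \<open>1\<close>, one \<open>n\<close>-th of the circle for each of the \<open>n\<close> edges.
  For \<open>es = []\<close> it is constant.\<close>

definition traverses ::
  "('p, 'e, 'f, 'm) complex2_scheme \<Rightarrow> (complex \<Rightarrow> 'p) \<Rightarrow> 'p \<Rightarrow> 'e list \<Rightarrow> bool" where
  "traverses C \<phi> y es \<longleftrightarrow>
     edge_path C y es y \<and>
     (es = [] \<longrightarrow> (\<forall>z\<in>sphere 0 1. \<phi> z = y)) \<and>
     (\<forall>k<length es. \<forall>t\<in>{0..1}.
        \<phi> (cis (2 * pi * (real k + t) / real (length es))) = echar C (es ! k) t)"

definition cell_structure :: "('p, 'e, 'f, 'm) complex2_scheme \<Rightarrow> bool" where
  "cell_structure C \<longleftrightarrow>
     (\<forall>e\<in>edges C.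
        echar C e 0 \<in> verts C \<and> echar C e 1 \<in> verts C \<and>
        inj_on (echar C e) {0<..<1} \<and> open_edge C e \<inter> verts C = {} \<and>
        einv C e \<in> edges C \<and> einv C e \<noteq> e \<and> einv C (einv C e) = e \<and>
        (\<forall>t\<in>{0..1}. echar C (einv C e) t = echar C e (1 - t)) \<and>
        (\<forall>e'\<in>edges C. e' \<noteq> e \<longrightarrow> e' \<noteq> einv C e \<longrightarrow> open_edge C e \<inter> open_edge C e' = {})) \<and>
     (\<forall>f\<in>faces C.
        fbdry C f \<noteq> [] \<and> traverses C (fchar C f) (fchar C f 1) (fbdry C f) \<and>
        inj_on (fchar C f) (ball 0 1) \<and> open_face C f \<inter> skeleton1 C = {} \<and>
        (\<forall>f'\<in>faces C. f' \<noteq> f \<longrightarrow> open_face C f \<inter> open_face C f' = {}))"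

text \<open>For a finite complex in a Hausdorff space, continuity of the characteristic maps makes the
  subspace topology on \<open>points C\<close> the CW topology.\<close>

definition finite_combinatorial_complex ::
  "('p::t2_space, 'e, 'f, 'm) complex2_scheme \<Rightarrow> bool" where
  "finite_combinatorial_complex C \<longleftrightarrow>
     cell_structure C \<and> finite (verts C) \<and> finite (edges C) \<and> finite (faces C) \<and>
     (\<forall>e\<in>edges C. continuous_on {0..1} (echar C e)) \<and>
     (\<forall>f\<in>faces C. continuous_on (cball 0 1) (fchar C f))"

section \<open>Coarse distance\<close>

text \<open>Path metric between vertices of a connected complex, every edge having length 1.\<close>

definition path_dist :: "('p, 'e, 'f, 'm) complex2_scheme \<Rightarrow> 'p \<Rightarrow> 'p \<Rightarrow> nat" where
  "path_dist C u v = (LEAST n. \<exists>es. edge_path C u es v \<and> length es = n)"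

definition coarse_dist_edge :: "('p, 'e, 'f, 'm) complex2_scheme \<Rightarrow> 'p \<Rightarrow> 'e \<Rightarrow> real" where
  "coarse_dist_edge C y e =
     min (real (path_dist C y (echar C e 0))) (real (path_dist C y (echar C e 1))) + 1/2"

definition coarse_dist_face :: "('p, 'e, 'f, 'm) complex2_scheme \<Rightarrow> 'p \<Rightarrow> 'f \<Rightarrow> real" where
  "coarse_dist_face C y f = Max (coarse_dist_edge C y ` set (fbdry C f)) - 1/4"

text \<open>The open cell containing \<open>p\<close> is unique up to the direction of an edge, on which
  \<open>coarse_dist_edge\<close> does not depend; so the choices below are immaterial.\<close>

definition coarse_dist :: "('p, 'e, 'f, 'm) complex2_scheme \<Rightarrow> 'p \<Rightarrow> 'p \<Rightarrow> real" where
  "coarse_dist C y p =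
     (if p \<in> verts C then real (path_dist C y p)
      else if \<exists>e\<in>edges C. p \<in> open_edge C e
      then coarse_dist_edge C y (SOME e. e \<in> edges C \<and> p \<in> open_edge C e)
      else coarse_dist_face C y (SOME f. f \<in> faces C \<and> p \<in> open_face C f))"

section \<open>The Cayley 2-complex\<close>

text \<open>
  The 1-skeleton is the Cayley graph: a directed edge \<open>(g, a)\<close> from \<open>g\<close> to \<open>g a\<close> for each
  \<open>g \<in> G\<close> and letter \<open>a\<close>, the inverse of \<open>(g, a)\<close> being \<open>(g a, a\<inverse>)\<close>. For each \<open>g\<close> and each
  relator \<open>r\<close> a 2-cell is attached along the loop at \<open>g\<close> labelled \<open>r\<close>.
  An interior point of an edge is recorded by its parameters in both directions.
\<close>

datatype ('g, 'a) cayley_point =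
  CVert 'g
| CEdge "('g \<times> 'a \<times> real) set"
| CFace 'g "'a list" complex

definition cayley_echar ::
  "('g, 'm) monoid_scheme \<Rightarrow> ('a, 'g) pres \<Rightarrow> 'g \<times> 'a \<Rightarrow> real \<Rightarrow> ('g, 'a) cayley_point" where
  "cayley_echar G P = (\<lambda>(g, a) t.
     if t = 0 then CVert g
     else if t = 1 then CVert (g \<otimes>\<^bsub>G\<^esub> val P a)
     else CEdge {(g, a, t), (g \<otimes>\<^bsub>G\<^esub> val P a, ainv P a, 1 - t)})"

fun cayley_path ::
  "('g, 'm) monoid_scheme \<Rightarrow> ('a, 'g) pres \<Rightarrow> 'g \<Rightarrow> 'a list \<Rightarrow> ('g \<times> 'a) list" where
  "cayley_path G P g [] = []"
| "cayley_path G P g (a # w) = (g, a) # cayley_path G P (g \<otimes>\<^bsub>G\<^esub> val P a) w"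

definition cayley_fchar ::
  "('g, 'm) monoid_scheme \<Rightarrow> ('a, 'g) pres \<Rightarrow> 'g \<times> 'a list \<Rightarrow> complex \<Rightarrow> ('g, 'a) cayley_point"
where
  "cayley_fchar G P = (\<lambda>(g, r) z.
     if norm z < 1 then CFace g r z
     else let s = real (length r) * Arg2pi z / (2 * pi)
          in cayley_echar G P (cayley_path G P g r ! nat \<lfloor>s\<rfloor>) (frac s))"

definition cayley_complex ::
  "('g, 'm) monoid_scheme \<Rightarrow> ('a, 'g) pres \<Rightarrow>
     (('g, 'a) cayley_point, 'g \<times> 'a, 'g \<times> 'a list) complex2" where
  "cayley_complex G P =
     \<lparr> verts = CVert ` carrier G,
       edges = carrier G \<times> alph P,
       einv = (\<lambda>(g, a). (g \<otimes>\<^bsub>G\<^esub> val P a, ainv P a)),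
       echar = cayley_echar G P,
       faces = carrier G \<times> rels P,
       fbdry = (\<lambda>(g, r). cayley_path G P g r),
       fchar = cayley_fchar G P \<rparr>"

section \<open>Van Kampen diagrams\<close>

text \<open>A diagram is a finite complex embedded in the plane; natural numbers suffice to index its
  finitely many edges and 2-cells.\<close>

record 'a diagram = "(complex, nat, nat) complex2" +
  label :: "nat \<Rightarrow> 'a"
  base :: complex

text \<open>
  The edge loop \<open>es\<close> at the basepoint is the counterclockwise boundary circuit of the diagram:
  it is the attaching map of the complementary cell of the sphere. That is, the exterior of the
  open unit disc maps to the plane, fixing infinity, so that \<open>norm z > 1\<close> goes
  homeomorphically and orientation-preservingly onto the complement of the diagram, and the unit
  circle, counterclockwise, traverses \<open>es\<close>. (The inverse of a continuous injection between
  open plane sets is continuous. Edges not in the boundary of any 2-cell are traversed twice.)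
\<close>

definition boundary_circuit :: "'a diagram \<Rightarrow> nat list \<Rightarrow> bool" where
  "boundary_circuit D es \<longleftrightarrow>
     (\<exists>\<Phi>. continuous_on {z. 1 \<le> norm z} \<Phi> \<and>
          inj_on \<Phi> {z. 1 < norm z} \<and>
          \<Phi> ` {z. 1 < norm z} = - points D \<and>
          filterlim \<Phi> at_infinity at_infinity \<and>
          winding_number (\<Phi> \<circ> circlepath 0 2) (base D) = 1 \<and>
          traverses D \<Phi> (base D) es)"

definition van_kampen_diagram :: "('a, 'g) pres \<Rightarrow> 'a list \<Rightarrow> 'a diagram \<Rightarrow> bool" where
  "van_kampen_diagram P w D \<longleftrightarrow>
     finite_combinatorial_complex D \<and>
     contractible (points D) \<and>
     base D \<in> verts D \<and>
     (\<forall>e\<in>edges D. label D e \<in> alph P \<and> label D (einv D e) = ainv P (label D e)) \<and>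
     (\<forall>f\<in>faces D. map (label D) (fbdry D f) \<in> rels P) \<and>
     (\<exists>es. boundary_circuit D es \<and> map (label D) es = w)"

text \<open>The canonical cellular map to the Cayley complex.\<close>

definition canonical_map ::
  "('g, 'm) monoid_scheme \<Rightarrow> ('a, 'g) pres \<Rightarrow> 'a diagram \<Rightarrow>
     (complex \<Rightarrow> ('g, 'a) cayley_point) \<Rightarrow> bool" where
  "canonical_map G P D \<pi> \<longleftrightarrow>
     \<pi> (base D) = CVert \<one>\<^bsub>G\<^esub> \<and>
     (\<forall>e\<in>edges D. \<exists>g\<in>carrier G. \<forall>t\<in>{0..1}.
        \<pi> (echar D e t) = echar (cayley_complex G P) (g, label D e) t) \<and>
     (\<forall>f\<in>faces D. \<exists>g\<in>carrier G. \<forall>z\<in>cball 0 1.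
        \<pi> (fchar D f z) = fchar (cayley_complex G P) (g, map (label D) (fbdry D f)) z)"

text \<open>The boundary of a diagram is its topological frontier in the plane.\<close>

definition van_kampen_homotopy :: "'a diagram \<Rightarrow> (complex \<times> real \<Rightarrow> complex) \<Rightarrow> bool" where
  "van_kampen_homotopy D \<Psi> \<longleftrightarrow>
     continuous_on (frontier (points D) \<times> {0..1}) \<Psi> \<and>
     \<Psi> ` (frontier (points D) \<times> {0..1}) \<subseteq> points D \<and>
     (\<forall>p\<in>frontier (points D). \<Psi> (p, 0) = base D \<and> \<Psi> (p, 1) = p) \<and>
     (\<forall>t\<in>{0..1}. \<Psi> (base D, t) = base D) \<and>
     (\<forall>p\<in>verts D \<inter> frontier (points D). \<forall>t\<in>{0..1}. \<Psi> (p, t) \<in> skeleton1 D)"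

section \<open>Diameter and tame filling inequalities\<close>

definition intrinsic_diameter_ineq ::
  "('g, 'm) monoid_scheme \<Rightarrow> ('a, 'g) pres \<Rightarrow> (nat \<Rightarrow> nat) \<Rightarrow> bool" where
  "intrinsic_diameter_ineq G P h \<longleftrightarrow>
     mono h \<and>
     (\<forall>w\<in>lists (alph P). word_val G P w = \<one>\<^bsub>G\<^esub> \<longrightarrow>
        (\<exists>D. van_kampen_diagram P w D \<and>
             (\<forall>v\<in>verts D. path_dist D (base D) v \<le> h (length w))))"

definition extrinsic_diameter_ineq ::
  "('g, 'm) monoid_scheme \<Rightarrow> ('a, 'g) pres \<Rightarrow> (nat \<Rightarrow> nat) \<Rightarrow> bool" where
  "extrinsic_diameter_ineq G P h \<longleftrightarrow>
     mono h \<and>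
     (\<forall>w\<in>lists (alph P). word_val G P w = \<one>\<^bsub>G\<^esub> \<longrightarrow>
        (\<exists>D \<pi>. van_kampen_diagram P w D \<and> canonical_map G P D \<pi> \<and>
             (\<forall>v\<in>verts D.
                path_dist (cayley_complex G P) (CVert \<one>\<^bsub>G\<^esub>) (\<pi> v) \<le> h (length w))))"

definition quarter_nats :: "real set" where
  "quarter_nats = range (\<lambda>n::nat. real n / 4)"

definition nondecreasing_quarter :: "(real \<Rightarrow> real) \<Rightarrow> bool" where
  "nondecreasing_quarter f \<longleftrightarrow> f ` quarter_nats \<subseteq> quarter_nats \<and> mono_on quarter_nats f"

definition intrinsic_tame_filling_ineq ::
  "('g, 'm) monoid_scheme \<Rightarrow> ('a, 'g) pres \<Rightarrow> (real \<Rightarrow> real) \<Rightarrow> bool" where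
  "intrinsic_tame_filling_ineq G P f \<longleftrightarrow>
     nondecreasing_quarter f \<and>
     (\<forall>w\<in>lists (alph P). word_val G P w = \<one>\<^bsub>G\<^esub> \<longrightarrow>
        (\<exists>D \<Psi>. van_kampen_diagram P w D \<and> van_kampen_homotopy D \<Psi> \<and>
           (\<forall>p\<in>frontier (points D). \<forall>s t. 0 \<le> s \<longrightarrow> s < t \<longrightarrow> t \<le> 1 \<longrightarrow>
              coarse_dist D (base D) (\<Psi> (p, s)) \<le> f (coarse_dist D (base D) (\<Psi> (p, t))))))"

definition extrinsic_tame_filling_ineq ::
  "('g, 'm) monoid_scheme \<Rightarrow> ('a, 'g) pres \<Rightarrow> (real \<Rightarrow> real) \<Rightarrow> bool" where
  "extrinsic_tame_filling_ineq G P f \<longleftrightarrow>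
     nondecreasing_quarter f \<and>
     (\<forall>w\<in>lists (alph P). word_val G P w = \<one>\<^bsub>G\<^esub> \<longrightarrow>
        (\<exists>D \<Psi> \<pi>. van_kampen_diagram P w D \<and> van_kampen_homotopy D \<Psi> \<and>
           canonical_map G P D \<pi> \<and>
           (\<forall>p\<in>frontier (points D). \<forall>s t. 0 \<le> s \<longrightarrow> s < t \<longrightarrow> t \<le> 1 \<longrightarrow>
              coarse_dist (cayley_complex G P) (CVert \<one>\<^bsub>G\<^esub>) (\<pi> (\<Psi> (p, s)))
                \<le> f (coarse_dist (cayley_complex G P) (CVert \<one>\<^bsub>G\<^esub>) (\<pi> (\<Psi> (p, t)))))))"

end

theory Submission
  imports Defs
begin

text \<open>
  Boundary points have coarse distance at most \<open>n = length w\<close>. A winding number argument shows that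
  a vertex \<open>v\<close> off the boundary is \<open>\<Psi> (p, s)\<close> for some boundary point \<open>p\<close> and \<open>s < 1\<close>, so the
  tameness inequality with \<open>t = 1\<close> bounds its distance by \<open>f n\<close>. This does not apply to a vertex \<open>v\<close>
  on the boundary, which may be reached only at \<open>s = 1\<close>. There the path \<open>\<Psi> (v, s)\<close> in the 1-skeleton
  must enter \<open>v\<close> through an incident edge, whose coarse distance is at least that of \<open>v\<close> minus 1/2;
  the loss of 1/2 is absorbed by the ceiling. Intrinsic and extrinsic versions are the cases of the
  identity and of the canonical map.
\<close>

section \<open>Path metric and coarse distance on the 1-skeleton\<close>

text \<open>The facts about the 1-skeleton on which path lengths and coarse distances of edge points
  rest, stated so that they can be verified both for planar diagrams and for the Cayley complex.
  Overlapping open edges are only required to share their endpoint set, because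
  \<open>coarse_dist_edge\<close> depends on nothing else.\<close>

definition graph_like :: "('p, 'e, 'f, 'm) complex2_scheme \<Rightarrow> bool" where
  "graph_like C \<longleftrightarrow>
     (\<forall>e\<in>edges C.
        echar C e 0 \<in> verts C \<and> echar C e 1 \<in> verts C \<and> open_edge C e \<inter> verts C = {} \<and>
        (\<exists>e'\<in>edges C. echar C e' 0 = echar C e 1 \<and> echar C e' 1 = echar C e 0) \<and>
        (\<forall>e'\<in>edges C. open_edge C e \<inter> open_edge C e' \<noteq> {} \<longrightarrow>
           {echar C e 0, echar C e 1} = {echar C e' 0, echar C e' 1}))"

lemma graph_likeD:
  assumes "graph_like C" "e \<in> edges C"
  shows "echar C e 0 \<in> verts C" "echar C e 1 \<in> verts C" "open_edge C e \<inter> verts C = {}"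
    "\<exists>e'\<in>edges C. echar C e' 0 = echar C e 1 \<and> echar C e' 1 = echar C e 0"
    "e' \<in> edges C \<Longrightarrow> open_edge C e \<inter> open_edge C e' \<noteq> {} \<Longrightarrow>
       {echar C e 0, echar C e 1} = {echar C e' 0, echar C e' 1}"
  using assms unfolding graph_like_def by blast+

lemma cell_structure_graph_like:
  assumes "cell_structure C"
  shows "graph_like C"
  unfolding graph_like_def
proof (intro ballI conjI impI)
  fix e assume e: "e \<in> edges C"
  have E: "echar C e 0 \<in> verts C" "echar C e 1 \<in> verts C" "open_edge C e \<inter> verts C = {}"
    "einv C e \<in> edges C" "\<forall>t\<in>{0..1}. echar C (einv C e) t = echar C e (1 - t)"
    and dis: "\<forall>e'\<in>edges C. e' \<noteq> e \<longrightarrow> e' \<noteq> einv C e \<longrightarrow> open_edge C e \<inter> open_edge C e' = {}"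
    using assms e unfolding cell_structure_def by blast+
  have inv: "echar C (einv C e) 0 = echar C e 1" "echar C (einv C e) 1 = echar C e 0"
    using E(5) by auto
  show "echar C e 0 \<in> verts C" "echar C e 1 \<in> verts C" "open_edge C e \<inter> verts C = {}"
    by (fact E)+
  show "\<exists>e'\<in>edges C. echar C e' 0 = echar C e 1 \<and> echar C e' 1 = echar C e 0"
    using inv E(4) by blast
  fix e' assume "e' \<in> edges C" "open_edge C e \<inter> open_edge C e' \<noteq> {}"
  then have "e' = e \<or> e' = einv C e" using dis by blast
  then show "{echar C e 0, echar C e 1} = {echar C e' 0, echar C e' 1}"
    using inv by auto
qed

lemma edge_path_append:
  "edge_path C u es v \<Longrightarrow> edge_path C v fs w \<Longrightarrow> edge_path C u (es @ fs) w"
  by (induction es arbitrary: u) auto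

lemma edge_path_take:
  assumes "graph_like C" "edge_path C u es w" "k < length es"
  shows "edge_path C u (take k es) (echar C (es ! k) 0)"
    "edge_path C u (take (Suc k) es) (echar C (es ! k) 1)" "es ! k \<in> edges C"
proof -
  have "edge_path C u (take k es) (echar C (es ! k) 0) \<and> 
    edge_path C u (take (Suc k) es) (echar C (es ! k) 1) \<and> es ! k \<in> edges C"
    using assms(2,3)
  proof (induction es arbitrary: u k)
    case (Cons e es)
    then show ?case
      using graph_likeD(1,2)[OF assms(1)] by (cases k) auto
  qed simp
  then show "edge_path C u (take k es) (echar C (es ! k) 0)"
    "edge_path C u (take (Suc k) es) (echar C (es ! k) 1)" "es ! k \<in> edges C" by auto
qed

lemma path_dist_le: "edge_path C u es v \<Longrightarrow> path_dist C u v \<le> length es"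
  unfolding path_dist_def by (rule Least_le) auto

text \<open>Some path has to be given: over an empty set of lengths \<open>LEAST\<close> would be an
  unspecified number. Later arguments therefore carry an explicit path from the basepoint.\<close>

lemma path_dist_attained:
  assumes "edge_path C u es v"
  shows "\<exists>fs. edge_path C u fs v \<and> length fs = path_dist C u v"
  unfolding path_dist_def
  by (rule LeastI_ex[where P = "\<lambda>n. \<exists>fs. edge_path C u fs v \<and> length fs = n"]) (use assms in auto)

lemma path_dist_edge:
  assumes "graph_like C" "e \<in> edges C" "edge_path C y es (echar C e 0)"
  shows "path_dist C y (echar C e 1) \<le> path_dist C y (echar C e 0) + 1"
proof -
  obtain fs where fs: "edge_path C y fs (echar C e 0)" "length fs = path_dist C y (echar C e 0)"
    using path_dist_attained[OF assms(3)] by blast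
  have "edge_path C (echar C e 0) [e] (echar C e 1)"
    using graph_likeD(2)[OF assms(1,2)] assms(2) by simp
  from path_dist_le[OF edge_path_append[OF fs(1) this]] fs(2) show ?thesis by simp
qed

lemma coarse_dist_edge_swap:
  assumes "{echar C e 0, echar C e 1} = {echar C e' 0, echar C e' 1}"
  shows "coarse_dist_edge C y e = coarse_dist_edge C y e'"
  using assms unfolding coarse_dist_edge_def by (auto simp: doubleton_eq_iff min.commute)

text \<open>The edge picked by \<open>SOME\<close> may differ from \<open>e\<close>, but both
  contain \<open>p\<close> in their interiors, hence have the same endpoints and the same coarse
  distance.\<close>

lemma coarse_dist_open_edge:
  assumes "graph_like C" "e \<in> edges C" "p \<in> open_edge C e"
  shows "coarse_dist C y p = coarse_dist_edge C y e"
proof -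
  define e' where "e' = (SOME e. e \<in> edges C \<and> p \<in> open_edge C e)"
  have e': "e' \<in> edges C" "p \<in> open_edge C e'"
    using someI[of "\<lambda>e. e \<in> edges C \<and> p \<in> open_edge C e" e] assms(2,3)
    unfolding e'_def by auto
  have "p \<notin> verts C" using graph_likeD(3)[OF assms(1,2)] assms(3) by blast
  then have "coarse_dist C y p = coarse_dist_edge C y e'"
    using assms(2,3) unfolding coarse_dist_def e'_def by auto
  also have "\<dots> = coarse_dist_edge C y e"
    by (rule coarse_dist_edge_swap, rule graph_likeD(5)[OF assms(1)]) (use e' assms in blast)+
  finally show ?thesis .
qed

lemma open_edgeI: "0 < t \<Longrightarrow> t < 1 \<Longrightarrow> echar C e t \<in> open_edge C e"
  unfolding open_edge_def by auto

lemma of_nat_in_quarter_nats: "real n \<in> quarter_nats"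
  unfolding quarter_nats_def by (rule image_eqI[where x = "4 * n"]) auto

text \<open>Needed because \<open>f\<close> is monotone only on \<open>quarter_nats\<close>: every
  argument at which monotonicity is applied must be shown to lie there.\<close>

lemma coarse_dist_in_quarter_nats:
  assumes "graph_like C" "e \<in> edges C" "t \<in> {0..1}"
  shows "coarse_dist C y (echar C e t) \<in> quarter_nats"
proof -
  have half: "real n + 1/2 \<in> quarter_nats" for n
    unfolding quarter_nats_def by (rule image_eqI[where x = "4 * n + 2"]) auto
  consider "t = 0" | "t = 1" | "0 < t" "t < 1" using assms(3) by fastforce
  then show ?thesis
  proof cases
    case 3
    then have "coarse_dist C y (echar C e t) = coarse_dist_edge C y e"
      using assms by (intro coarse_dist_open_edge open_edgeI)
    then show ?thesis unfolding coarse_dist_edge_def by (metis half of_nat_min)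
  qed (use graph_likeD(1,2)[OF assms(1,2)] of_nat_in_quarter_nats in \<open>auto simp: coarse_dist_def\<close>)
qed

text \<open>Prefixes of the path bound the distances of the two ends of edge number \<open>k\<close>
  by \<open>k\<close> and \<open>k + 1\<close>, so an interior point has coarse distance at most
  \<open>k + 1/2\<close>.\<close>

lemma coarse_dist_edge_path:
  assumes "graph_like C" "edge_path C y es z" "k < length es" "t \<in> {0..1}"
  shows "coarse_dist C y (echar C (es ! k) t) \<le> real (length es)"
proof -
  note ep = edge_path_take[OF assms(1-3)]
  have le: "path_dist C y (echar C (es ! k) 0) \<le> k" "path_dist C y (echar C (es ! k) 1) \<le> Suc k"
    using path_dist_le[OF ep(1)] path_dist_le[OF ep(2)] assms(3) by auto
  consider "t = 0" | "t = 1" | "0 < t" "t < 1" using assms(4) by fastforce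
  then show ?thesis
  proof cases
    case 3
    then have "coarse_dist C y (echar C (es ! k) t) = coarse_dist_edge C y (es ! k)"
      using assms ep by (intro coarse_dist_open_edge open_edgeI)
    then show ?thesis unfolding coarse_dist_edge_def using le assms(3) by linarith
  qed (use graph_likeD(1,2)[OF assms(1) ep(3)] le assms(3) in \<open>auto simp: coarse_dist_def\<close>)
qed

text \<open>The other end of the edge is at most 1 closer to \<open>y\<close> than \<open>v\<close>,
  so the minimum over both ends drops by at most 1, and the summand 1/2 in the coarse distance
  restores half of that.\<close>

lemma coarse_dist_edge_ge:
  assumes "graph_like C" "e \<in> edges C" "edge_path C y es v" "v \<in> {echar C e 0, echar C e 1}"
  shows "real (path_dist C y v) - 1/2 \<le> coarse_dist_edge C y e"
proof -
  have main: "real (path_dist C y (echar C e 0)) - 1/2 \<le> coarse_dist_edge C y e"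
    if e: "e \<in> edges C" and es: "edge_path C y es (echar C e 0)" for e
  proof -
    obtain e' where e': "e' \<in> edges C" "echar C e' 0 = echar C e 1" "echar C e' 1 = echar C e 0"
      using graph_likeD(4)[OF assms(1) e] by blast
    have "edge_path C (echar C e 0) [e] (echar C e 1)"
      using graph_likeD(2)[OF assms(1) e] e by simp
    from path_dist_edge[OF assms(1) e'(1), unfolded e'(2,3), OF edge_path_append[OF es this]]
    show ?thesis unfolding coarse_dist_edge_def by linarith
  qed
  \<comment> \<open>\<open>main\<close> treats \<open>v\<close> as the initial end; if
    \<open>v\<close> is the terminal end, it is applied to a reversed edge, which has the same
    coarse distance.\<close>
  obtain e' where e': "e' \<in> edges C" "echar C e' 0 = echar C e 1" "echar C e' 1 = echar C e 0"
    using graph_likeD(4)[OF assms(1,2)] by blast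
  have "coarse_dist_edge C y e' = coarse_dist_edge C y e"
    by (rule coarse_dist_edge_swap) (use e' in auto)
  then show ?thesis using main[OF assms(2)] main[OF e'(1)] e' assms(3,4) by auto
qed

section \<open>Topology of diagrams\<close>

lemma traverses_sphere:
  assumes "traverses C \<phi> y es" "z \<in> sphere 0 1" "es \<noteq> []"
  obtains k t where "k < length es" "t \<in> {0..1}" "\<phi> z = echar C (es ! k) t"
proof -
  define n where "n = length es"
  have n: "0 < n" using assms(3) by (simp add: n_def)
  \<comment> \<open>This inverts the parametrization in \<open>traverses\<close>. Since
    \<open>Arg2pi\<close> takes values in the half-open interval from 0 to 2 pi,
    \<open>s < n\<close>, so the integer part of \<open>s\<close> is always a valid edge index and
    the fractional part is the parameter on that edge.\<close>
  define s where "s = real n * Arg2pi z / (2 * pi)"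
  have s0: "0 \<le> s" unfolding s_def using Arg2pi_ge_0[of z] by simp
  have "Arg2pi z / (2 * pi) < 1" using Arg2pi_lt_2pi[of z] by simp
  then have s1: "s < real n" unfolding s_def using n
    by (metis mult.right_neutral mult_strict_left_mono of_nat_0_less_iff times_divide_eq_right)
  define k where "k = nat \<lfloor>s\<rfloor>"
  have kt: "real k + frac s = s" using s0 unfolding k_def frac_def by simp
  have k: "k < n" using kt s1 frac_ge_0[of s] by linarith
  have fr: "frac s \<in> {0..1}" using frac_ge_0[of s] frac_lt_1[of s] by auto
  have "2 * pi * (real k + frac s) / real n = Arg2pi z"
    unfolding kt unfolding s_def using n by simp
  moreover have "cis (Arg2pi z) = z"
    using assms(2) Arg2pi_eq[of z] by (simp add: cis_conv_exp)
  ultimately have "\<phi> z = echar C (es ! k) (frac s)"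
    using assms(1) k fr unfolding traverses_def n_def by metis
  then show ?thesis using that k fr n_def by blast
qed

lemma echar_in_skeleton1:
  assumes "graph_like C" "e \<in> edges C" "t \<in> {0..1}"
  shows "echar C e t \<in> skeleton1 C"
proof -
  consider "t = 0" | "t = 1" | "0 < t" "t < 1" using assms(3) by fastforce
  then show ?thesis
    unfolding skeleton1_def using graph_likeD(1,2)[OF assms(1,2)] open_edgeI[of t C e] assms(2)
    by cases auto
qed

lemma traverses_sphere_subset:
  assumes "graph_like C" "traverses C \<phi> y es" "y \<in> verts C"
  shows "\<phi> ` sphere 0 1 \<subseteq> skeleton1 C"
proof (cases "es = []")
  case True
  then show ?thesis using assms unfolding traverses_def skeleton1_def by auto
next
  case False
  show ?thesis
  proof (rule image_subsetI)
    fix z :: complex assume "z \<in> sphere 0 1"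
    then obtain k t where kt: "k < length es" "t \<in> {0..1}" "\<phi> z = echar C (es ! k) t"
      using traverses_sphere[OF assms(2) _ False] by metis
    have "edge_path C y es y" using assms(2) unfolding traverses_def by blast
    from edge_path_take(3)[OF assms(1) this kt(1)] kt(2,3)
    show "\<phi> z \<in> skeleton1 C" using echar_in_skeleton1[OF assms(1)] by auto
  qed
qed

lemma compact_echar:
  assumes "finite_combinatorial_complex C" "e \<in> edges C"
  shows "compact (echar C e ` {0..1})"
  using assms unfolding finite_combinatorial_complex_def
  by (intro compact_continuous_image) auto

lemma echar_image_eq:
  "echar C e ` {0..1} = insert (echar C e 0) (insert (echar C e 1) (open_edge C e))"
proof -
  have "{0..1} = insert 0 (insert 1 {0<..<1::real})" by auto
  then show ?thesis unfolding open_edge_def by (metis image_insert)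
qed

text \<open>The canonical map is constrained only on edges and faces; this is what determines its value
  at the vertices other than the basepoint.\<close>

lemma vertex_on_edge:
  assumes fin: "finite_combinatorial_complex C" and con: "connected (points C)"
    and v: "v \<in> verts C" and b: "b \<in> verts C" "b \<noteq> v"
  shows "\<exists>e\<in>edges C. v \<in> {echar C e 0, echar C e 1}"
proof (rule ccontr)
  assume *: "\<not> ?thesis"
  then have no: "v \<notin> {echar C e 0, echar C e 1}" if "e \<in> edges C" for e
    using that * by blast
  have cell: "cell_structure C" using fin unfolding finite_combinatorial_complex_def by blast
  note gl = cell_structure_graph_like[OF cell]
  \<comment> \<open>If no edge ends at \<open>v\<close>, the union of all other closed cells is
    closed and misses \<open>v\<close>. Then \<open>{v}\<close> and \<open>K\<close> disconnect the
    complex, \<open>b\<close> showing that the second piece is nonempty.\<close>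
  define K where "K = (verts C - {v}) \<union> (\<Union>e\<in>edges C. echar C e ` {0..1}) \<union>
    (\<Union>f\<in>faces C. fchar C f ` cball 0 1)"
  have "compact K"
    unfolding K_def
  proof (intro compact_Un compact_UN)
    show "compact (fchar C f ` cball 0 1)" if "f \<in> faces C" for f
      using fin that unfolding finite_combinatorial_complex_def
      by (intro compact_continuous_image) auto
  qed (use fin compact_echar[OF fin] in
      \<open>auto simp: finite_combinatorial_complex_def intro: finite_imp_compact\<close>)
  then have "closed K" by (rule compact_imp_closed)
  have ve: "v \<notin> echar C e ` {0..1}" if "e \<in> edges C" for e
    using no[OF that] graph_likeD(3)[OF gl that] v unfolding echar_image_eq by blast
  \<comment> \<open>A closed 2-cell could meet \<open>v\<close> only on its boundary circle, which
    runs along closed edges, and these miss \<open>v\<close>.\<close>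
  have vf: "v \<notin> fchar C f ` cball 0 1" if f: "f \<in> faces C" for f
  proof
    assume "v \<in> fchar C f ` cball 0 1"
    then obtain z where z: "z \<in> cball 0 1" "v = fchar C f z" by blast
    have F: "fbdry C f \<noteq> []" "traverses C (fchar C f) (fchar C f 1) (fbdry C f)"
      "open_face C f \<inter> skeleton1 C = {}"
      using cell f unfolding cell_structure_def by blast+
    have "v \<notin> open_face C f" using F(3) v unfolding skeleton1_def by blast
    then have "z \<in> sphere 0 1" using z unfolding open_face_def by force
    then obtain k t where kt: "k < length (fbdry C f)" "t \<in> {0..1}"
      "fchar C f z = echar C (fbdry C f ! k) t"
      using traverses_sphere[OF F(2) _ F(1)] by metis
    have "edge_path C (fchar C f 1) (fbdry C f) (fchar C f 1)"
      using F(2) unfolding traverses_def by blast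
    from ve[OF edge_path_take(3)[OF gl this kt(1)]] kt z show False by auto
  qed
  have "v \<notin> K" using ve vf unfolding K_def by blast
  have "points C \<subseteq> {v} \<union> K"
    unfolding points_def skeleton1_def open_face_def K_def echar_image_eq by force
  moreover have "v \<in> points C" "b \<in> points C" using v b unfolding points_def skeleton1_def by auto
  moreover have "b \<in> K" using b unfolding K_def by blast
  ultimately show False
    using con[unfolded connected_closed] \<open>closed K\<close> \<open>v \<notin> K\<close> closed_singleton[of v] by blast
qed

section \<open>The boundary loop, its contraction, and paths ending at a vertex\<close>

text \<open>The unit circle lies in the closure of the open exterior, so by continuity its image
  lies in the closure of the complement of \<open>S\<close>. This puts the boundary loop where van
  Kampen homotopies are defined.\<close>

lemma exterior_map_sphere_frontier:
  fixes \<Phi> :: "complex \<Rightarrow> complex"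
  assumes "continuous_on {z. 1 \<le> norm z} \<Phi>" "\<Phi> ` {z. 1 < norm z} \<subseteq> - S" "\<Phi> ` sphere 0 1 \<subseteq> S"
  shows "\<Phi> ` sphere 0 1 \<subseteq> frontier S"
proof -
  have eq: "{z::complex. 1 < norm z} = - cball 0 1" by auto
  have cl: "closure {z::complex. 1 < norm z} = {z. 1 \<le> norm z}"
    unfolding eq closure_complement by (auto simp: not_less)
  have "\<Phi> ` closure {z. 1 < norm z} \<subseteq> closure (- S)"
    by (rule image_closure_subset) (use assms closure_subset[of "- S"] in \<open>auto simp: cl\<close>)
  then have "\<Phi> ` sphere 0 1 \<subseteq> closure (- S)" unfolding cl by fastforce
  then show ?thesis
    using assms(3) closure_subset[of S] unfolding frontier_closures by blast
qed

text \<open>A missed point \<open>v\<close> would have winding number 0, by contracting the boundary loop along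
  \<open>\<Psi>\<close>, and winding number 1, by pushing that loop into the exterior.\<close>

lemma contraction_of_boundary_surj:
  fixes \<Phi> :: "complex \<Rightarrow> complex" and \<Psi> :: "complex \<times> real \<Rightarrow> complex"
  assumes con: "connected S" and b: "b \<in> S" and v: "v \<in> S"
    and \<Phi>: "continuous_on {z. 1 \<le> norm z} \<Phi>" "\<Phi> ` {z. 1 < norm z} \<subseteq> - S"
    and wind: "winding_number (\<Phi> \<circ> circlepath 0 2) b = 1"
    and \<Psi>: "continuous_on (\<Phi> ` sphere 0 1 \<times> {0..1}) \<Psi>"
      "\<And>p. p \<in> \<Phi> ` sphere 0 1 \<Longrightarrow> \<Psi> (p, 0) = b \<and> \<Psi> (p, 1) = p"
  obtains z s where "z \<in> sphere 0 1" "s \<in> {0..1}" "v = \<Psi> (\<Phi> z, s)"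
proof (rule ccontr)
  assume "\<not> thesis"
  then have miss: "\<And>z s. z \<in> sphere 0 1 \<Longrightarrow> s \<in> {0..1} \<Longrightarrow> \<Psi> (\<Phi> z, s) \<noteq> v"
    using that by metis
  \<comment> \<open>Times 1 and 0 of the homotopy show that \<open>v\<close> is neither on the
    boundary loop nor equal to \<open>b\<close>.\<close>
  have v1: "\<Phi> z \<noteq> v" if "z \<in> sphere 0 1" for z using miss[OF that, of 1] \<Psi>(2) that by auto
  have vb: "v \<noteq> b" using miss[of 1 0] \<Psi>(2)[of "\<Phi> 1"] by auto
  have sub: "\<Phi> ` {z. 1 \<le> norm z} \<subseteq> - {v}"
  proof
    fix q assume "q \<in> \<Phi> ` {z. 1 \<le> norm z}"
    then obtain z where z: "1 \<le> norm z" "q = \<Phi> z" by blast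
    show "q \<in> - {v}"
    proof (cases "norm z = 1")
      case True then show ?thesis using v1 z by auto
    next
      case False
      then have "q \<in> - S" using z \<Phi>(2) by fastforce
      then show ?thesis using v by auto
    qed
  qed
  \<comment> \<open>The winding hypothesis concerns the circle of radius 2, whereas \<Psi> is
    available over the unit circle; radial segments connect the two inside the domain of
    \<Phi>.\<close>
  have circ: "homotopic_loops {z. 1 \<le> norm z} (circlepath (0::complex) 1) (circlepath 0 2)"
  proof (rule homotopic_loops_linear)
    fix t :: real assume "t \<in> {0..1}"
    show "closed_segment (circlepath (0::complex) 1 t) (circlepath 0 2 t) \<subseteq> {z. 1 \<le> norm z}"
    proof
      fix z assume "z \<in> closed_segment (circlepath (0::complex) 1 t) (circlepath 0 2 t)"
      then obtain u where u: "0 \<le> u" "u \<le> 1"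
        "z = (1 - u) *\<^sub>R circlepath 0 1 t + u *\<^sub>R circlepath 0 2 t"
        by (auto simp: in_segment)
      have "z = of_real (1 + u) * exp (2 * of_real pi * \<i> * of_real t)"
        unfolding u(3) circlepath by (simp add: scaleR_conv_of_real algebra_simps)
      then have "norm z = \<bar>1 + u\<bar>" by (simp add: norm_mult del: of_real_add)
      then show "z \<in> {z. 1 \<le> norm z}" using u by simp
    qed
  qed auto
  have h12: "homotopic_loops (- {v}) (\<Phi> \<circ> circlepath 0 1) (\<Phi> \<circ> circlepath 0 2)"
    by (rule homotopic_loops_continuous_image[OF circ \<Phi>(1)]) (use sub in blast)
  have circ_in: "circlepath 0 1 x \<in> sphere (0::complex) 1" if "x \<in> {0..1}" for x
    using that path_image_circlepath_nonneg[of 1 "0::complex"] unfolding path_image_def by fastforce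
  \<comment> \<open>Running \<Psi> backwards in time, hence \<open>1 - fst y\<close>, shrinks the
    boundary loop to \<open>b\<close> without crossing \<open>v\<close>.\<close>
  have h10: "homotopic_loops (- {v}) (\<Phi> \<circ> circlepath 0 1) (linepath b b)"
    unfolding homotopic_loops
  proof (intro exI conjI ballI)
    let ?h = "\<lambda>y::real \<times> real. \<Psi> (\<Phi> (circlepath 0 1 (snd y)), 1 - fst y)"
    have c1: "continuous_on ({0..1} \<times> {0..1}) (\<lambda>y::real \<times> real. \<Phi> (circlepath 0 1 (snd y)))"
    proof (rule continuous_on_compose2[OF \<Phi>(1)])
      show "continuous_on ({0..1} \<times> {0..1}) (\<lambda>y::real \<times> real. circlepath (0::complex) 1 (snd y))"
        unfolding circlepath by (intro continuous_intros)
      show "(\<lambda>y::real \<times> real. circlepath (0::complex) 1 (snd y)) ` ({0..1} \<times> {0..1}) \<subseteq> {z. 1 \<le> norm z}"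
        using circ_in by force
    qed
    show "continuous_on ({0..1} \<times> {0..1}) ?h"
    proof (rule continuous_on_compose2[OF \<Psi>(1)])
      show "continuous_on ({0..1} \<times> {0..1})
          (\<lambda>y::real \<times> real. (\<Phi> (circlepath 0 1 (snd y)), 1 - fst y))"
        by (intro continuous_intros c1)
    qed (use circ_in in auto)
    show "?h \<in> {0..1} \<times> {0..1} \<rightarrow> - {v}"
    proof (rule Pi_I)
      fix y :: "real \<times> real" assume "y \<in> {0..1} \<times> {0..1}"
      then have "?h y \<noteq> v" by (intro miss circ_in) auto
      then show "?h y \<in> - {v}" by simp
    qed
    fix x :: real assume "x \<in> {0..1}"
    then show "?h (0, x) = (\<Phi> \<circ> circlepath 0 1) x" "?h (1, x) = linepath b b x"
      using \<Psi>(2) circ_in by (auto simp: linepath_refl)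
  next
    fix t :: real assume "t \<in> {0..1}"
    show "pathfinish ((\<lambda>y. \<Psi> (\<Phi> (circlepath 0 1 (snd y)), 1 - fst y)) \<circ> Pair t) =
      pathstart ((\<lambda>y. \<Psi> (\<Phi> (circlepath 0 1 (snd y)), 1 - fst y)) \<circ> Pair t)"
      by (simp add: pathfinish_def pathstart_def circlepath)
  qed
  define \<gamma> where "\<gamma> = \<Phi> \<circ> circlepath 0 2"
  have "homotopic_loops (- {v}) \<gamma> (linepath b b)"
    using homotopic_loops_trans[OF homotopic_loops_sym[OF h12] h10] unfolding \<gamma>_def .
  then have "winding_number \<gamma> v = winding_number (linepath b b) v"
    by (rule winding_number_homotopic_loops)
  also have "\<dots> = 0" using vb by (intro winding_number_trivial)
  finally have "winding_number \<gamma> v = 0" .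
  \<comment> \<open>The loop of radius 2 maps into the complement of \<open>S\<close>, so its
    winding number is constant on the connected set \<open>S\<close>.\<close>
  moreover have "winding_number \<gamma> b = winding_number \<gamma> v"
  proof (rule winding_number_eq)
    show "path \<gamma>" using homotopic_loops_imp_path[OF h12] unfolding \<gamma>_def by blast
    show "pathfinish \<gamma> = pathstart \<gamma>" using homotopic_loops_imp_loop[OF h12] unfolding \<gamma>_def by blast
    have "path_image \<gamma> = \<Phi> ` sphere 0 2"
      unfolding \<gamma>_def path_image_compose by simp
    then show "S \<inter> path_image \<gamma> = {}" using \<Phi>(2) by fastforce
  qed (use con b v in auto)
  ultimately show False using wind unfolding \<gamma>_def by simp
qed

text \<open>The other vertices together with the closed edges not incident to \<open>v\<close> form
  a closed set missing \<open>v\<close>. By continuity the path avoids it shortly before time 1, and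
  what remains of the 1-skeleton is the open star of \<open>v\<close>. The strict
  \<open>s < 1\<close> is what lets tameness compare this point with time 1.\<close>

lemma path_enters_open_star:
  fixes c :: "real \<Rightarrow> 'p::t2_space"
  assumes fin: "finite_combinatorial_complex C"
    and c: "continuous_on {0..1} c" "c ` {0..1} \<subseteq> skeleton1 C" "c 1 = v" and v: "v \<in> verts C"
  obtains s where "0 \<le> s" "s < 1"
    "c s = v \<or> (\<exists>e\<in>edges C. v \<in> {echar C e 0, echar C e 1} \<and> c s \<in> open_edge C e)"
proof -
  define K where "K = (verts C - {v}) \<union>
    (\<Union>e\<in>{e\<in>edges C. v \<notin> {echar C e 0, echar C e 1}}. echar C e ` {0..1})"
  have gl: "graph_like C"
    using fin cell_structure_graph_like unfolding finite_combinatorial_complex_def by blast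
  have "compact K"
    unfolding K_def
    by (intro compact_Un compact_UN) (use fin compact_echar[OF fin] in
      \<open>auto simp: finite_combinatorial_complex_def intro: finite_imp_compact\<close>)
  then have "closed K" by (rule compact_imp_closed)
  have "v \<notin> K" using graph_likeD(3)[OF gl] v unfolding K_def echar_image_eq by blast
  have "(c \<longlongrightarrow> c 1) (at 1 within {0..1})"
    using c(1) by (auto simp: continuous_on_def)
  then have "eventually (\<lambda>s. c s \<in> - K) (at 1 within {0..1})"
    by (rule topological_tendstoD) (use \<open>closed K\<close> \<open>v \<notin> K\<close> c(3) in auto)
  then obtain d where d: "d > 0" "\<And>s. s \<in> {0..1} \<Longrightarrow> s \<noteq> 1 \<Longrightarrow> dist s 1 < d \<Longrightarrow> c s \<in> - K"
    unfolding eventually_at by blast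
  \<comment> \<open>The maximum with 0 keeps \<open>s\<close> in the unit interval when
    \<open>d\<close> exceeds 2.\<close>
  define s where "s = max 0 (1 - d/2)"
  have s: "0 \<le> s" "s < 1" "dist s 1 < d" using d(1) unfolding s_def dist_real_def by auto
  then have "c s \<notin> K" "c s \<in> skeleton1 C" using d(2)[of s] c(2) by auto
  then have "c s = v \<or> (\<exists>e\<in>edges C. v \<in> {echar C e 0, echar C e 1} \<and> c s \<in> open_edge C e)"
    unfolding K_def skeleton1_def echar_image_eq by blast
  then show ?thesis using that s by blast
qed

section \<open>From tame fillings to diameter bounds\<close>

text \<open>Edges are carried to edges with the same parameter, so paths keep their length and
  interior edge points stay interior. \<open>map_vert\<close> is a separate condition since an
  isolated vertex lies on no edge.\<close>

locale graph_map =
  fixes D :: "('p, 'e, 'f, 'm) complex2_scheme" and Y :: "('q, 'e2, 'f2, 'm2) complex2_scheme"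
    and \<pi> :: "'p \<Rightarrow> 'q"
  assumes graph_like_target: "graph_like Y"
    and map_vert: "v \<in> verts D \<Longrightarrow> \<pi> v \<in> verts Y"
    and map_edge: "e \<in> edges D \<Longrightarrow> \<exists>e'\<in>edges Y. \<forall>t\<in>{0..1}. \<pi> (echar D e t) = echar Y e' t"
begin

lemma map_edge_path:
  assumes "graph_like D" "edge_path D u es v"
  shows "\<exists>es'. edge_path Y (\<pi> u) es' (\<pi> v) \<and> length es' = length es \<and>
    (\<forall>k<length es. \<forall>t\<in>{0..1}. \<pi> (echar D (es ! k) t) = echar Y (es' ! k) t)"
  using assms(2)
proof (induction es arbitrary: u)
  case Nil
  then show ?case using map_vert by (intro exI[of _ "[]"]) auto
next
  case (Cons e es)
  then have e: "e \<in> edges D" "echar D e 0 = u" and p: "edge_path D (echar D e 1) es v" by auto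
  obtain es' where es': "edge_path Y (\<pi> (echar D e 1)) es' (\<pi> v)" "length es' = length es"
    "\<forall>k<length es. \<forall>t\<in>{0..1}. \<pi> (echar D (es ! k) t) = echar Y (es' ! k) t"
    using Cons.IH[OF p] by blast
  obtain e' where e': "e' \<in> edges Y" "\<forall>t\<in>{0..1}. \<pi> (echar D e t) = echar Y e' t"
    using map_edge[OF e(1)] by blast
  have "echar Y e' 0 = \<pi> u" "echar Y e' 1 = \<pi> (echar D e 1)" using e' e(2) by auto
  then show ?case
    using es' e' by (intro exI[of _ "e' # es'"]) (auto simp: nth_Cons split: nat.split)
qed

lemma map_open_edge:
  assumes "e \<in> edges D"
  obtains e' where "e' \<in> edges Y" "\<pi> (echar D e 0) = echar Y e' 0" "\<pi> (echar D e 1) = echar Y e' 1"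
    "\<And>p. p \<in> open_edge D e \<Longrightarrow> \<pi> p \<in> open_edge Y e'"
proof -
  obtain e' where e': "e' \<in> edges Y" "\<forall>t\<in>{0..1}. \<pi> (echar D e t) = echar Y e' t"
    using map_edge[OF assms] by blast
  show ?thesis by (rule that[OF e'(1)]) (use e'(2) in \<open>force simp: open_edge_def\<close>)+
qed

end

lemma tame_filling_vertex_bound:
  fixes D :: "'a diagram"
  assumes gm: "graph_map D Y \<pi>" and vk: "van_kampen_diagram P w D"
    and hom: "van_kampen_homotopy D \<Psi>" and f: "nondecreasing_quarter f"
    and tame: "\<And>p s t. p \<in> frontier (points D) \<Longrightarrow> 0 \<le> s \<Longrightarrow> s < t \<Longrightarrow> t \<le> 1 \<Longrightarrow>
      coarse_dist Y (\<pi> (base D)) (\<pi> (\<Psi> (p, s))) \<le> f (coarse_dist Y (\<pi> (base D)) (\<pi> (\<Psi> (p, t))))"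
    and v: "v \<in> verts D"
  shows "path_dist Y (\<pi> (base D)) (\<pi> v) \<le> nat \<lceil>f (real (length w))\<rceil>"
proof -
  interpret graph_map D Y \<pi> by (fact gm)
  define y where "y = \<pi> (base D)"
  define n where "n = length w"
  have fin: "finite_combinatorial_complex D" and b: "base D \<in> verts D"
    and con: "connected (points D)"
    using vk contractible_imp_connected unfolding van_kampen_diagram_def by blast+
  have gl: "graph_like D"
    using fin cell_structure_graph_like unfolding finite_combinatorial_complex_def by blast
  obtain es \<Phi> where n: "length es = n" and \<Phi>: "continuous_on {z. 1 \<le> norm z} \<Phi>"
    "\<Phi> ` {z. 1 < norm z} = - points D" "winding_number (\<Phi> \<circ> circlepath 0 2) (base D) = 1"
    and trav: "traverses D \<Phi> (base D) es"
    using vk unfolding van_kampen_diagram_def boundary_circuit_def n_def by force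
  have H: "continuous_on (frontier (points D) \<times> {0..1}) \<Psi>"
    "\<And>p. p \<in> frontier (points D) \<Longrightarrow> \<Psi> (p, 0) = base D \<and> \<Psi> (p, 1) = p"
    "\<And>p t. p \<in> verts D \<inter> frontier (points D) \<Longrightarrow> t \<in> {0..1} \<Longrightarrow> \<Psi> (p, t) \<in> skeleton1 D"
    using hom unfolding van_kampen_homotopy_def by blast+
  have ep: "edge_path D (base D) es (base D)" using trav unfolding traverses_def by blast
  obtain es' where es': "edge_path Y y es' y" "length es' = n"
    "\<And>k t. k < n \<Longrightarrow> t \<in> {0..1} \<Longrightarrow> \<pi> (echar D (es ! k) t) = echar Y (es' ! k) t"
    using map_edge_path[OF gl ep] n unfolding y_def by blast
  have sph: "\<Phi> ` sphere 0 1 \<subseteq> points D"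
    using traverses_sphere_subset[OF gl trav b] unfolding points_def by blast
  have fr: "\<Phi> ` sphere 0 1 \<subseteq> frontier (points D)"
    using exterior_map_sphere_frontier[OF \<Phi>(1) _ sph] \<Phi>(2) by blast
  \<comment> \<open>Every boundary point lies on the loop \<open>es\<close>, whose image
    \<open>es'\<close> is a loop at \<open>y\<close> of length \<open>n\<close>. For the empty word
    there is no edge to use: the circle is mapped constantly to the basepoint, at distance
    0.\<close>
  have bdry: "f (coarse_dist Y y (\<pi> p)) \<le> f (real n)" if p: "p \<in> \<Phi> ` sphere 0 1" for p
  proof -
    obtain z where z: "z \<in> sphere 0 1" "p = \<Phi> z" using p by blast
    have "coarse_dist Y y (\<pi> p) \<in> quarter_nats \<and> coarse_dist Y y (\<pi> p) \<le> real n"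
    proof (cases "es = []")
      case True
      then have "p = base D" using trav z unfolding traverses_def by blast
      moreover have "edge_path Y y [] y" using map_vert[OF b] unfolding y_def by simp
      from path_dist_le[OF this] have "path_dist Y y y = 0" by simp
      ultimately have "coarse_dist Y y (\<pi> p) = 0"
        unfolding coarse_dist_def using map_vert[OF b] by (simp add: y_def)
      then show ?thesis unfolding quarter_nats_def by (auto intro: image_eqI[where x = 0])
    next
      case False
      then obtain k t where kt: "k < n" "t \<in> {0..1}" "\<Phi> z = echar D (es ! k) t"
        using traverses_sphere[OF trav z(1)] n by metis
      then have "\<pi> p = echar Y (es' ! k) t" using es'(3) z by simp
      moreover have "es' ! k \<in> edges Y"
        using edge_path_take(3)[OF graph_like_target es'(1)] es'(2) kt(1) by simp
      ultimately show ?thesis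
        using coarse_dist_in_quarter_nats[OF graph_like_target _ kt(2)]
          coarse_dist_edge_path[OF graph_like_target es'(1) _ kt(2)] es'(2) kt(1) by simp
    qed
    then show ?thesis using f of_nat_in_quarter_nats unfolding nondecreasing_quarter_def mono_on_def by blast
  qed
  have \<pi>v: "coarse_dist Y y (\<pi> v) = real (path_dist Y y (\<pi> v))"
    using map_vert[OF v] unfolding coarse_dist_def by simp
  have "real (path_dist Y y (\<pi> v)) - 1/2 \<le> f (real n)"
  proof (cases "v \<in> \<Phi> ` sphere 0 1")
    case True
    then have vfr: "v \<in> frontier (points D)" using fr by blast
    \<comment> \<open>A prefix of the boundary loop supplies the path that
      \<open>coarse_dist_edge_ge\<close> requires; a vertex on a closed edge can only be one of its
      ends.\<close>
    have reach: "\<exists>fs. edge_path D (base D) fs v"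
    proof (cases "es = []")
      case True
      with \<open>v \<in> \<Phi> ` sphere 0 1\<close> have "v = base D" using trav unfolding traverses_def by blast
      then show ?thesis using b by (intro exI[of _ "[]"]) auto
    next
      case False
      obtain k t where kt: "k < length es" "t \<in> {0..1}" "v = echar D (es ! k) t"
        using traverses_sphere[OF trav _ False] True by (metis imageE)
      have "v \<notin> open_edge D (es ! k)"
        using graph_likeD(3)[OF gl edge_path_take(3)[OF gl ep kt(1)]] v by blast
      then have "t = 0 \<or> t = 1" using kt open_edgeI[of t D "es ! k"] by fastforce
      then show ?thesis using edge_path_take(1,2)[OF gl ep kt(1)] kt(3) by blast
    qed
    then obtain fs where fs: "edge_path Y y fs (\<pi> v)"
      using map_edge_path[OF gl] unfolding y_def by blast
    have "continuous_on {0..1} (\<lambda>s. \<Psi> (v, s))"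
      by (rule continuous_on_compose2[OF H(1)]) (use vfr in \<open>auto intro!: continuous_intros\<close>)
    then obtain s where s: "0 \<le> s" "s < 1"
      "\<Psi> (v, s) = v \<or>
        (\<exists>e\<in>edges D. v \<in> {echar D e 0, echar D e 1} \<and> \<Psi> (v, s) \<in> open_edge D e)"
      by (rule path_enters_open_star[OF fin, where v = v]) (use H(2,3) vfr v in auto)
    have "real (path_dist Y y (\<pi> v)) - 1/2 \<le> coarse_dist Y y (\<pi> (\<Psi> (v, s)))"
      using s(3)
    proof (elim disjE bexE conjE)
      fix e assume e: "e \<in> edges D" "v \<in> {echar D e 0, echar D e 1}" "\<Psi> (v, s) \<in> open_edge D e"
      obtain e' where e': "e' \<in> edges Y" "\<pi> (echar D e 0) = echar Y e' 0"
        "\<pi> (echar D e 1) = echar Y e' 1" "\<pi> (\<Psi> (v, s)) \<in> open_edge Y e'"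
        using map_open_edge[OF e(1)] e(3) by metis
      have "\<pi> v \<in> {echar Y e' 0, echar Y e' 1}" using e(2) e' by auto
      from coarse_dist_edge_ge[OF graph_like_target e'(1) fs this]
      show ?thesis using coarse_dist_open_edge[OF graph_like_target e'(1,4)] by simp
    qed (simp add: \<pi>v)
    also have "\<dots> \<le> f (coarse_dist Y y (\<pi> (\<Psi> (v, 1))))"
      using tame[OF vfr s(1,2)] unfolding y_def by simp
    also have "\<dots> \<le> f (real n)" using bdry[OF True] H(2)[OF vfr] by simp
    finally show ?thesis .
  next
    case False
    obtain z s where z: "z \<in> sphere 0 1" "s \<in> {0..1}" "v = \<Psi> (\<Phi> z, s)"
    proof (rule contraction_of_boundary_surj[OF con _ _ \<Phi>(1) _ \<Phi>(3), of v \<Psi>])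
      show "base D \<in> points D" "v \<in> points D"
        using b v unfolding points_def skeleton1_def by auto
      show "continuous_on (\<Phi> ` sphere 0 1 \<times> {0..1}) \<Psi>"
        by (rule continuous_on_subset[OF H(1)]) (use fr in auto)
    qed (use H(2) fr \<Phi>(2) in auto)
    have zfr: "\<Phi> z \<in> frontier (points D)" using z fr by blast
    \<comment> \<open>At time 1 the homotopy returns the boundary point itself, but \<open>v\<close>
      is off the boundary loop.\<close>
    have "s \<noteq> 1" using False z H(2)[OF zfr] by auto
    then have "coarse_dist Y y (\<pi> v) \<le> f (coarse_dist Y y (\<pi> (\<Phi> z)))"
      using tame[OF zfr, of s 1] z H(2)[OF zfr] unfolding y_def by simp
    also have "\<dots> \<le> f (real n)" using bdry z by blast
    finally show ?thesis using \<pi>v by simp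
  qed
  \<comment> \<open>The distance is an integer exceeding the ceiling, also an integer, by at most
    1/2, hence not at all.\<close>
  then have "int (path_dist Y y (\<pi> v)) \<le> \<lceil>f (real n)\<rceil>"
    by linarith
  then show ?thesis unfolding y_def n_def by linarith
qed

section \<open>The Cayley complex and the canonical map\<close>

text \<open>An interior edge point is the set of its descriptions in both directions. Equality of
  two such sets forces the directed edges to coincide or to be mutually inverse, and
  \<open>return_trip\<close> then matches their endpoints.\<close>

lemma cayley_complex_graph_like:
  assumes "group G" "symmetric_generators G P"
  shows "graph_like (cayley_complex G P)"
proof -
  interpret group G by fact
  have A: "ainv P a \<in> alph P" "ainv P (ainv P a) = a" "val P a \<in> carrier G"
    "val P (ainv P a) = inv\<^bsub>G\<^esub> (val P a)" if "a \<in> alph P" for a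
    using assms(2) that unfolding symmetric_generators_def by auto
  have return_trip: "g \<otimes>\<^bsub>G\<^esub> val P a \<otimes>\<^bsub>G\<^esub> val P (ainv P a) = g" if "g \<in> carrier G" "a \<in> alph P" for g a
    using that A by (simp add: m_assoc)
  have ends: "cayley_echar G P (g, a) 0 = CVert g"
    "cayley_echar G P (g, a) 1 = CVert (g \<otimes>\<^bsub>G\<^esub> val P a)" for g a
    by (auto simp: cayley_echar_def)
  show ?thesis
    unfolding graph_like_def
  proof (intro ballI conjI impI)
    fix e assume "e \<in> edges (cayley_complex G P)"
    then obtain g a where e: "e = (g, a)" "g \<in> carrier G" "a \<in> alph P"
      by (auto simp: cayley_complex_def)
    show "echar (cayley_complex G P) e 0 \<in> verts (cayley_complex G P)"
      "echar (cayley_complex G P) e 1 \<in> verts (cayley_complex G P)"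
      using e A by (auto simp: cayley_complex_def ends)
    show "open_edge (cayley_complex G P) e \<inter> verts (cayley_complex G P) = {}"
      by (auto simp: e open_edge_def cayley_complex_def cayley_echar_def)
    show "\<exists>e'\<in>edges (cayley_complex G P).
        echar (cayley_complex G P) e' 0 = echar (cayley_complex G P) e 1 \<and>
        echar (cayley_complex G P) e' 1 = echar (cayley_complex G P) e 0"
      using e A return_trip
      by (intro bexI[of _ "(g \<otimes>\<^bsub>G\<^esub> val P a, ainv P a)"]) (auto simp: cayley_complex_def ends)
    fix e' assume "e' \<in> edges (cayley_complex G P)"
    then obtain h c where e': "e' = (h, c)" "h \<in> carrier G" "c \<in> alph P"
      by (auto simp: cayley_complex_def)
    assume "open_edge (cayley_complex G P) e \<inter> open_edge (cayley_complex G P) e' \<noteq> {}"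
    then obtain t u where "t \<in> {0<..<1}" "u \<in> {0<..<1}"
      "cayley_echar G P (g, a) t = cayley_echar G P (h, c) u"
      unfolding e(1) e'(1) open_edge_def cayley_complex_def complex2.simps by blast
    then have
      "{(g, a, t), (g \<otimes>\<^bsub>G\<^esub> val P a, ainv P a, 1 - t)} =
       {(h, c, u), (h \<otimes>\<^bsub>G\<^esub> val P c, ainv P c, 1 - u)}"
      by (simp add: cayley_echar_def)
    then have "(g = h \<and> a = c) \<or> (g = h \<otimes>\<^bsub>G\<^esub> val P c \<and> a = ainv P c)"
      by (auto simp: doubleton_eq_iff)
    then show "{echar (cayley_complex G P) e 0, echar (cayley_complex G P) e 1} =
      {echar (cayley_complex G P) e' 0, echar (cayley_complex G P) e' 1}"
      using return_trip[OF e'(2,3)] by (auto simp: e e' cayley_complex_def ends)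
  qed
qed

text \<open>Edges are immediate from the definition. A vertex other than the basepoint is an end of
  some edge by \<open>vertex_on_edge\<close>, so its image is an end of a Cayley edge; the basepoint
  is separate, since a one-vertex diagram may have no edges.\<close>

lemma canonical_map_graph_map:
  assumes pres: "group G" "symmetric_generators G P"
    and vk: "van_kampen_diagram P w D" and can: "canonical_map G P D \<pi>"
  shows "graph_map D (cayley_complex G P) \<pi>"
proof
  show gl: "graph_like (cayley_complex G P)" by (rule cayley_complex_graph_like[OF pres])
  show edge: "\<exists>e'\<in>edges (cayley_complex G P).
      \<forall>t\<in>{0..1}. \<pi> (echar D e t) = echar (cayley_complex G P) e' t" if e: "e \<in> edges D" for e
  proof -
    obtain g where "g \<in> carrier G"
      "\<forall>t\<in>{0..1}. \<pi> (echar D e t) = echar (cayley_complex G P) (g, label D e) t"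
      using can e unfolding canonical_map_def by blast
    moreover have "label D e \<in> alph P" using vk e unfolding van_kampen_diagram_def by blast
    ultimately show ?thesis
      by (intro bexI[of _ "(g, label D e)"]) (auto simp: cayley_complex_def)
  qed
  fix v assume v: "v \<in> verts D"
  show "\<pi> v \<in> verts (cayley_complex G P)"
  proof (cases "v = base D")
    case True
    interpret group G by (fact pres(1))
    have "\<pi> v = CVert \<one>\<^bsub>G\<^esub>" using can True unfolding canonical_map_def by blast
    then show ?thesis by (simp add: cayley_complex_def)
  next
    case False
    obtain e where e: "e \<in> edges D" "v \<in> {echar D e 0, echar D e 1}"
      using vertex_on_edge[of D v "base D"] vk v False contractible_imp_connected
      unfolding van_kampen_diagram_def by metis
    obtain e' where e': "e' \<in> edges (cayley_complex G P)"
      "\<forall>t\<in>{0..1}. \<pi> (echar D e t) = echar (cayley_complex G P) e' t"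
      using edge[OF e(1)] by blast
    from e' have "\<pi> (echar D e 0) = echar (cayley_complex G P) e' 0"
      "\<pi> (echar D e 1) = echar (cayley_complex G P) e' 1" by auto
    then show ?thesis using e(2) graph_likeD(1,2)[OF gl e'(1)] by auto
  qed
qed

section \<open>Both diameter inequalities\<close>

lemma mono_ceiling_quarter:
  assumes "nondecreasing_quarter f"
  shows "mono (\<lambda>n::nat. nat \<lceil>f (real n)\<rceil>)"
proof (rule monoI)
  fix m n :: nat assume "m \<le> n"
  then have "f (real m) \<le> f (real n)"
    using assms of_nat_in_quarter_nats unfolding nondecreasing_quarter_def mono_on_def by auto
  then show "nat \<lceil>f (real m)\<rceil> \<le> nat \<lceil>f (real n)\<rceil>" by (intro nat_mono ceiling_mono)
qed

theorem proposition2p1: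
  fixes G :: "('g, 'm) monoid_scheme" and P :: "('a, 'g) pres" and f :: "real \<Rightarrow> real"
  assumes "finite_presentation G P" and "nondecreasing_quarter f"
  shows "(intrinsic_tame_filling_ineq G P f \<longrightarrow>
            intrinsic_diameter_ineq G P (\<lambda>n. nat \<lceil>f (real n)\<rceil>)) \<and>
         (extrinsic_tame_filling_ineq G P f \<longrightarrow>
            extrinsic_diameter_ineq G P (\<lambda>n. nat \<lceil>f (real n)\<rceil>))"
proof (intro conjI impI)
  assume tame: "intrinsic_tame_filling_ineq G P f"
  show "intrinsic_diameter_ineq G P (\<lambda>n. nat \<lceil>f (real n)\<rceil>)"
    unfolding intrinsic_diameter_ineq_def
  proof (intro conjI mono_ceiling_quarter assms(2) ballI impI)
    fix w assume "w \<in> lists (alph P)" "word_val G P w = \<one>\<^bsub>G\<^esub>"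
    then obtain D \<Psi> where D: "van_kampen_diagram P w D" "van_kampen_homotopy D \<Psi>"
      and t: "\<forall>p\<in>frontier (points D). \<forall>s t. 0 \<le> s \<longrightarrow> s < t \<longrightarrow> t \<le> 1 \<longrightarrow>
              coarse_dist D (base D) (\<Psi> (p, s)) \<le> f (coarse_dist D (base D) (\<Psi> (p, t)))"
      using tame unfolding intrinsic_tame_filling_ineq_def by blast
    have gl: "graph_like D"
      using D(1) cell_structure_graph_like
      unfolding van_kampen_diagram_def finite_combinatorial_complex_def by blast
    have gm: "graph_map D D (\<lambda>p. p)" by standard (use gl in auto)
    have "path_dist D (base D) v \<le> nat \<lceil>f (real (length w))\<rceil>" if "v \<in> verts D" for v
      by (rule tame_filling_vertex_bound[OF gm D assms(2) _ that]) (use t in blast)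
    then show "\<exists>D. van_kampen_diagram P w D \<and>
        (\<forall>v\<in>verts D. path_dist D (base D) v \<le> nat \<lceil>f (real (length w))\<rceil>)"
      using D(1) by blast
  qed
next
  assume tame: "extrinsic_tame_filling_ineq G P f"
  have pres: "group G" "symmetric_generators G P"
    using assms(1) unfolding finite_presentation_def by blast+
  let ?X = "cayley_complex G P"
  show "extrinsic_diameter_ineq G P (\<lambda>n. nat \<lceil>f (real n)\<rceil>)"
    unfolding extrinsic_diameter_ineq_def
  proof (intro conjI mono_ceiling_quarter assms(2) ballI impI)
    fix w assume "w \<in> lists (alph P)" "word_val G P w = \<one>\<^bsub>G\<^esub>"
    then obtain D \<Psi> \<pi> where D: "van_kampen_diagram P w D" "van_kampen_homotopy D \<Psi>"
      and can: "canonical_map G P D \<pi>"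
      and t: "\<forall>p\<in>frontier (points D). \<forall>s t. 0 \<le> s \<longrightarrow> s < t \<longrightarrow> t \<le> 1 \<longrightarrow>
              coarse_dist ?X (CVert \<one>\<^bsub>G\<^esub>) (\<pi> (\<Psi> (p, s)))
                \<le> f (coarse_dist ?X (CVert \<one>\<^bsub>G\<^esub>) (\<pi> (\<Psi> (p, t))))"
      using tame unfolding extrinsic_tame_filling_ineq_def by blast
    have base: "\<pi> (base D) = CVert \<one>\<^bsub>G\<^esub>" using can unfolding canonical_map_def by blast
    note gm = canonical_map_graph_map[OF pres D(1) can]
    have "path_dist ?X (CVert \<one>\<^bsub>G\<^esub>) (\<pi> v) \<le> nat \<lceil>f (real (length w))\<rceil>" if "v \<in> verts D" for v
      by (rule tame_filling_vertex_bound[OF gm D assms(2) _ that, unfolded base]) (use t in blast)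
    then show "\<exists>D \<pi>. van_kampen_diagram P w D \<and> canonical_map G P D \<pi> \<and>
        (\<forall>v\<in>verts D. path_dist ?X (CVert \<one>\<^bsub>G\<^esub>) (\<pi> v) \<le> nat \<lceil>f (real (length w))\<rceil>)"
      using D(1) can by blast
  qed
qed

end
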